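(* Let $C_n$ be the cycle graph on $n\ge4$ vertices. Then $\ell(C_n)=2n-2$.
   Context: A word $w$ over the alphabet $V$ word-represents a graph $G=(V,E)$ if $w$ contains every letter of $V$ at least once and for all distinct $x,y\in V$, $xy\in E$ if and only if $x$ and $y$ alternate in $w$ (the subword of $w$ consisting only of occurrences of $x$ and $y$ has no two equal consecutive letters). $\ell(G)$ is the minimum length of a word that word-represents $G$. *)

theory Defs
  imports "Graph_Theory.Pair_Digraph"
begin

text \<open>
  Simple graphs are the finite, loop-free, symmetric relations of locale \<open>pair_graph\<close>:
  an undirected edge is represented by its two orientations.
\<close>

definition alternate :: "'a \<Rightarrow> 'a \<Rightarrow> 'a list \<Rightarrow> bool" where
  "alternate x y w \<longleftrightarrow> distinct_adj (filter (\<lambda>z. z = x \<or> z = y) w)"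

definition word_represents :: "'a list \<Rightarrow> 'a pair_pre_digraph \<Rightarrow> bool" where
  "word_represents w G \<longleftrightarrow>
     set w = pverts G \<and>
     (\<forall>x\<in>pverts G. \<forall>y\<in>pverts G. x \<noteq> y \<longrightarrow> ((x, y) \<in> parcs G \<longleftrightarrow> alternate x y w))"

text \<open>
  The value is meaningful only if some word represents the graph.
\<close>

definition min_word_length :: "'a pair_pre_digraph \<Rightarrow> nat" where
  "min_word_length G = (LEAST k. \<exists>w. word_represents w G \<and> length w = k)"

text \<open>
  This is a simple graph (the \<open>n\<close>-cycle) for \<open>n \<ge> 3\<close>; for \<open>n = 1\<close> it has a loop.
\<close>

definition cycle_graph :: "nat \<Rightarrow> nat pair_pre_digraph" where
  "cycle_graph n =
     \<lparr> pverts = {0..<n},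
       parcs = (\<Union>i\<in>{0..<n}. {(i, Suc i mod n), (Suc i mod n, i)}) \<rparr>"

lemma pair_graph_cycle_graph:
  assumes "n \<ge> 3"
  shows "pair_graph (cycle_graph n)"
proof
  fix e assume e: "e \<in> parcs (cycle_graph n)"
  then show "fst e \<in> pverts (cycle_graph n)" "snd e \<in> pverts (cycle_graph n)"
    using assms by (auto simp: cycle_graph_def)
  from e show "fst e \<noteq> snd e"
    using assms by (auto simp: cycle_graph_def mod_Suc split: if_splits)
next
  show "finite (pverts (cycle_graph n))" "finite (parcs (cycle_graph n))"
    by (auto simp: cycle_graph_def)
  show "symmetric (with_proj (cycle_graph n))"
    by (auto simp: symmetric_def arcs_ends_def arc_to_ends_def sym_def cycle_graph_def)
qed

end

theory Submission
  imports Defs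
begin

text \<open>
  Letters that occur only once pairwise alternate, so they form a clique. For \<open>n \<ge> 4\<close> the cycle has
  no triangle, hence all but at most two letters occur at least twice, and a representing word has
  length at least \<open>2n - 2\<close>. The bound is attained by the word \<open>1 0 \<cdot> 2 1 \<cdot> 3 2 \<cdots> (n-1) (n-2)\<close>,
  in which only the adjacent vertices \<open>0\<close> and \<open>n - 1\<close> occur once.
\<close>

lemma alternate_commute: "alternate x y w \<longleftrightarrow> alternate y x w"
  by (simp add: alternate_def disj_commute)

lemma distinct_if_count_list_le_1: "(\<And>a. count_list xs a \<le> 1) \<Longrightarrow> distinct xs"
proof (induction xs)
  case (Cons x xs)
  have "count_list xs a \<le> 1" for a
    using Cons.prems[of a] by (auto split: if_splits)
  moreover have "x \<notin> set xs"
    using Cons.prems[of x] by (simp add: count_list_0_iff)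
  ultimately show ?case using Cons.IH by simp
qed simp

text \<open>Restricting \<open>w\<close> to \<open>x\<close> and \<open>y\<close> leaves a word
  without repeated letters, so no two neighbours in it coincide.\<close>

lemma alternate_if_count_list_1:
  assumes "count_list w x = 1" "count_list w y = 1"
  shows "alternate x y w"
proof -
  have "count_list (filter (\<lambda>z. z = x \<or> z = y) w) a =
      (if a = x \<or> a = y then count_list w a else 0)" for a
    by (induction w) auto
  then have "distinct (filter (\<lambda>z. z = x \<or> z = y) w)"
    using assms by (intro distinct_if_count_list_le_1) auto
  then show ?thesis
    by (simp add: alternate_def distinct_adj_conv_nth nth_eq_iff_index_eq)
qed

text \<open>Ordering the endpoints removes \<open>mod\<close>: the only edge that wraps around joins
  \<open>0\<close> and \<open>n - 1\<close>.\<close>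

lemma parcs_cycle_graph_iff:
  assumes "i < j" "j < n"
  shows "(i, j) \<in> parcs (cycle_graph n) \<longleftrightarrow> j = Suc i \<or> (i = 0 \<and> Suc j = n)"
    (is "?L \<longleftrightarrow> ?R")
proof
  assume ?L
  with assms show ?R by (auto simp: cycle_graph_def mod_Suc split: if_splits)
next
  assume ?R
  then show ?L
  proof
    assume "j = Suc i"
    with assms show ?thesis by (auto simp: cycle_graph_def intro!: bexI[of _ i])
  next
    assume "i = 0 \<and> Suc j = n"
    with assms show ?thesis by (auto simp: cycle_graph_def intro!: bexI[of _ j])
  qed
qed

lemma parcs_cycle_graph_commute:
  "(i, j) \<in> parcs (cycle_graph n) \<longleftrightarrow> (j, i) \<in> parcs (cycle_graph n)"
  by (auto simp: cycle_graph_def)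

text \<open>Since \<open>j\<close> is neither \<open>0\<close> nor \<open>n - 1\<close>, the first
  two edges are successor steps. Then \<open>k = i + 2\<close>, so the third edge must wrap around,
  which forces \<open>n = 3\<close>.\<close>

lemma cycle_graph_triangle_free:
  assumes "n \<ge> 4" "i < j" "j < k" "k < n"
    "(i, j) \<in> parcs (cycle_graph n)" "(j, k) \<in> parcs (cycle_graph n)"
    "(i, k) \<in> parcs (cycle_graph n)"
  shows False
  using assms parcs_cycle_graph_iff[of i j n] parcs_cycle_graph_iff[of j k n]
    parcs_cycle_graph_iff[of i k n] by simp

lemma card_gt_2_obtains_chain:
  fixes S :: "nat set"
  assumes "card S > 2"
  obtains i j k where "i \<in> S" "j \<in> S" "k \<in> S" "i < j" "j < k"
proof -
  have S: "finite S" using assms by (metis card.infinite not_less_zero)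
  let ?xs = "sorted_list_of_set S"
  have len: "length ?xs > 2" using assms S by simp
  have "?xs ! 0 < ?xs ! 1" "?xs ! 1 < ?xs ! 2"
    using len sorted_wrt_nth_less[OF strict_sorted_list_of_set[of S]] by simp_all
  moreover have "?xs ! m \<in> S" if "m \<le> 2" for m
    using nth_mem[of m ?xs] S len that by simp
  ultimately show ?thesis
    using that[of "?xs ! 0" "?xs ! 1" "?xs ! 2"] by simp
qed

lemma length_ge_if_represents_cycle_graph:
  assumes "n \<ge> 4" and w: "word_represents w (cycle_graph n)"
  shows "length w \<ge> 2 * n - 2"
proof -
  have V: "set w = {0..<n}"
    using w by (simp add: word_represents_def cycle_graph_def)
  define S where "S = {x \<in> {0..<n}. count_list w x = 1}"
  have arc: "(x, y) \<in> parcs (cycle_graph n)" if "x \<in> S" "y \<in> S" "x < y" for x y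
    using w that alternate_if_count_list_1[of w x y] V
    by (auto simp: word_represents_def S_def)
  have "card S \<le> 2"
  proof (rule ccontr)
    assume "\<not> card S \<le> 2"
    then obtain i j k where "i \<in> S" "j \<in> S" "k \<in> S" "i < j" "j < k"
      using card_gt_2_obtains_chain[of S] by (metis not_le)
    moreover from \<open>k \<in> S\<close> have "k < n" by (simp add: S_def)
    ultimately show False
      using cycle_graph_triangle_free[OF \<open>n \<ge> 4\<close>, of i j k] by (simp add: arc)
  qed
  have "2 * n = (\<Sum>x\<in>{0..<n}. 2)" by simp
  \<comment> \<open>Each letter of \<open>S\<close> falls one short of two occurrences; the
    indicator makes up for it, at total cost \<open>card S\<close>.\<close>
  also have "\<dots> \<le> (\<Sum>x\<in>{0..<n}. count_list w x + (if x \<in> S then 1 else 0))"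
  proof (rule sum_mono)
    fix x assume "x \<in> {0..<n}"
    then have "count_list w x \<noteq> 0" using V by (simp add: count_list_0_iff)
    with \<open>x \<in> {0..<n}\<close> show "2 \<le> count_list w x + (if x \<in> S then 1 else 0)"
      by (auto simp: S_def)
  qed
  also have "\<dots> = length w + card S"
  proof -
    have "(\<Sum>x\<in>{0..<n}. if x \<in> S then 1 else 0) = card S"
      by (auto simp: sum.If_cases S_def Int_def)
    then show ?thesis
      using V by (simp add: sum.distrib flip: sum_count_set[of w "{0..<n}"])
  qed
  finally show ?thesis using \<open>card S \<le> 2\<close> by linarith
qed

text \<open>The parameter counts blocks and is also the largest letter, so for \<open>m > 0\<close>
  the word is meant for the cycle on \<open>Suc m\<close> vertices.\<close>

definition cycle_word :: "nat \<Rightarrow> nat list" where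
  "cycle_word m = concat (map (\<lambda>i. [Suc i, i]) [0..<m])"

lemma cycle_word_0 [simp]: "cycle_word 0 = []"
  by (simp add: cycle_word_def)

lemma cycle_word_Suc [simp]: "cycle_word (Suc m) = cycle_word m @ [Suc m, m]"
  by (simp add: cycle_word_def)

lemma length_cycle_word: "length (cycle_word m) = 2 * m"
  by (induction m) auto

lemma set_cycle_word_Suc: "set (cycle_word (Suc m)) = {0..Suc m}"
proof (induction m)
  case (Suc m)
  have "set (cycle_word (Suc (Suc m))) = {0..Suc m} \<union> {Suc (Suc m), Suc m}"
    by (simp only: cycle_word_Suc[of "Suc m"] set_append Suc.IH list.set)
  also have "\<dots> = {0..Suc (Suc m)}" by auto
  finally show ?case .
qed auto

text \<open>Block \<open>i\<close> is \<open>[Suc i, i]\<close>, so a letter \<open>i\<close> comes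
  first from block \<open>i - 1\<close> and then from block \<open>i\<close>. Blocks
  \<open>i - 1\<close>, \<open>i\<close>, \<open>i + 1\<close> thus give
  \<open>i, Suc i, i, Suc i\<close>; the conditions drop the blocks outside
  \<open>0..<m\<close>.\<close>

lemma filter_cycle_word_Suc:
  "filter (\<lambda>z. z = i \<or> z = Suc i) (cycle_word m) =
    (if 0 < i \<and> i \<le> m then [i] else []) @ (if i < m then [Suc i, i] else []) @
    (if Suc i < m then [Suc i] else [])"
proof (induction m)
  case (Suc m)
  \<comment> \<open>The three middle cases are those in which the new block
    \<open>[Suc m, m]\<close> contains \<open>i\<close> or \<open>Suc i\<close>.\<close>
  have "Suc m < i \<or> i = Suc m \<or> i = m \<or> Suc i = m \<or> Suc i < m"
    by linarith
  then show ?case using Suc.IH by (elim disjE) simp_all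
qed auto

text \<open>As \<open>i < j - 1\<close>, the blocks \<open>i - 1\<close> and \<open>i\<close>
  holding \<open>i\<close> all precede the blocks \<open>j - 1\<close> and \<open>j\<close> holding
  \<open>j\<close>.\<close>

lemma filter_cycle_word:
  assumes "Suc i < j"
  shows "filter (\<lambda>z. z = i \<or> z = j) (cycle_word m) =
    (if 0 < i \<and> i \<le> m then [i] else []) @ (if i < m then [i] else []) @
    (if j \<le> m then [j] else []) @ (if j < m then [j] else [])"
proof (induction m)
  case (Suc m)
  have "Suc m < i \<or> i = Suc m \<or> i = m \<or> i < m"
    and "Suc m < j \<or> j = Suc m \<or> j = m \<or> j < m"
    by linarith+
  then show ?case using Suc.IH assms by (elim disjE) simp_all
qed (use assms in auto)

text \<open>For non-consecutive letters the restriction contains \<open>i, i\<close> unless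
  \<open>i = 0\<close>, and \<open>j, j\<close> unless \<open>j = m\<close>. Only the two end
  letters escape both repetitions, which yields the edge that closes the cycle.\<close>

lemma alternate_cycle_word_iff:
  assumes "i < j" "j \<le> m"
  shows "alternate i j (cycle_word m) \<longleftrightarrow> j = Suc i \<or> (i = 0 \<and> j = m)"
proof (cases "j = Suc i")
  case True
  with assms show ?thesis by (simp add: alternate_def filter_cycle_word_Suc)
next
  case False
  with assms have "Suc i < j" by simp
  with assms show ?thesis by (auto simp add: alternate_def filter_cycle_word)
qed

lemma word_represents_cycle_word:
  assumes "m > 0"
  shows "word_represents (cycle_word m) (cycle_graph (Suc m))"
proof -
  have *: "(i, j) \<in> parcs (cycle_graph (Suc m)) \<longleftrightarrow> alternate i j (cycle_word m)"
    if "i < j" "j < Suc m" for i j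
    using that by (simp add: parcs_cycle_graph_iff alternate_cycle_word_iff)
  have "(i, j) \<in> parcs (cycle_graph (Suc m)) \<longleftrightarrow> alternate i j (cycle_word m)"
    if "i \<noteq> j" "i < Suc m" "j < Suc m" for i j
    using that *[of i j] *[of j i] parcs_cycle_graph_commute[of i j "Suc m"]
      alternate_commute[of i j "cycle_word m"]
    by (cases "i < j") auto
  moreover have "pverts (cycle_graph (Suc m)) = {0..<Suc m}"
    by (simp add: cycle_graph_def)
  ultimately show ?thesis
    using set_cycle_word_Suc[of "m - 1"] assms by (auto simp: word_represents_def)
qed

theorem theorem5:
  fixes n :: nat
  assumes "n \<ge> 4"
  shows "min_word_length (cycle_graph n) = 2 * n - 2"
  unfolding min_word_length_def
proof (rule Least_equality)
  have "word_represents (cycle_word (n - 1)) (cycle_graph n)"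
    using word_represents_cycle_word[of "n - 1"] assms by simp
  moreover have "length (cycle_word (n - 1)) = 2 * n - 2"
    by (simp add: length_cycle_word)
  ultimately show "\<exists>w. word_represents w (cycle_graph n) \<and> length w = 2 * n - 2"
    by blast
next
  fix k
  assume "\<exists>w. word_represents w (cycle_graph n) \<and> length w = k"
  then show "2 * n - 2 \<le> k"
    using length_ge_if_represents_cycle_graph[OF assms] by blast
qed

end
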